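(* Let $A$ be a finite alphabet and $L\subseteq H_A$ a regular forest language with syntactic forest algebra $(H_L,V_L)$. If $L$ is locally testable, then $L$ is $(|H_L|^2+1)$-locally testable.
   Context: Forest algebras. A forest algebra $(H,V)$ consists of a commutative monoid $H$ (additive, identity $0$), a monoid $V$, and a faithful right action $H\times V\to H$ such that for $v\in V$, $h\in H$ there is $v+h\in V$ with $g(v+h)=gv+h$ for all $g\in H$; homomorphisms are pairs of monoid homomorphisms compatible with the action. Free forest algebra. $A^{\Delta}=(H_A,V_A)$: $H_A$ is the set of finite forests (finite multisets of finite rooted trees, unordered children) with nodes labeled by letters of $A$, with $+$ disjoint union and $0$ the empty forest; $V_A$ is the set of contexts (forests with exactly one leaf replaced by a hole); $sp$ substitutes forest $s$ into the hole of $p$, $pq$ substitutes $p$ into the hole of $q$. A forest language $L\subseteq H_A$ is regular if $L=\alpha^{-1}(X)$ for some homomorphism $\alpha$ into a finite forest algebra and some $X$. Its syntactic forest algebra $(H_L,V_L)$ is the quotient of $A^{\Delta}$ by the syntactic congruence ($s\approx t$ iff for all $p\in V_A$, $sp\in L\Leftrightarrow tp\in L$; $p\approx q$ iff $sp\approx sq$ for all $s\in H_A$); it is finite and divides every forest algebra recognizing $L$. Definite types and local testability. All nodes have the same $0$-definite type; for $k>0$ the $k$-definite type of a node is $(a,T)$ with $a$ its label and $T$ the set of $(k-1)$-definite types of its children. For $k>0$, $s\equiv_k t$ iff the sets of $(k-1)$-definite types of the roots of $s$ and $t$ coincide and the sets of $k$-definite types of all nodes of $s$ and $t$ coincide. $L$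 is $k$-locally testable if it is a union of $\equiv_k$-classes, and locally testable if it is $k$-locally testable for some $k$. *)

theory Defs
  imports Main "HOL-Library.Multiset" "HOL-Library.FSet" "HOL-Algebra.Group"
begin

section \<open>Forest algebras\<close>

text \<open>The monoid \<open>hor F\<close> is written additively on paper; the record type only offers the
  multiplicative notation. The action is a right action: \<open>act F h v\<close> is \<open>hv\<close>.\<close>

record ('h, 'v) forest_alg =
  hor :: "'h monoid"
  ver :: "'v monoid"
  act :: "'h \<Rightarrow> 'v \<Rightarrow> 'h"

locale forest_algebra =
  fixes F :: "('h, 'v) forest_alg"
  assumes comm_monoid_hor: "comm_monoid (hor F)"
    and monoid_ver: "monoid (ver F)"
    and act_closed: "\<lbrakk>h \<in> carrier (hor F); v \<in> carrier (ver F)\<rbrakk> \<Longrightarrow> act F h v \<in> carrier (hor F)"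
    and act_one: "h \<in> carrier (hor F) \<Longrightarrow> act F h \<one>\<^bsub>ver F\<^esub> = h"
    and act_mult: "\<lbrakk>h \<in> carrier (hor F); v \<in> carrier (ver F); w \<in> carrier (ver F)\<rbrakk>
      \<Longrightarrow> act F h (v \<otimes>\<^bsub>ver F\<^esub> w) = act F (act F h v) w"
    and act_faithful: "\<lbrakk>v \<in> carrier (ver F); w \<in> carrier (ver F);
      \<And>h. h \<in> carrier (hor F) \<Longrightarrow> act F h v = act F h w\<rbrakk> \<Longrightarrow> v = w"
    and act_insert: "\<lbrakk>v \<in> carrier (ver F); h \<in> carrier (hor F)\<rbrakk>
      \<Longrightarrow> \<exists>w\<in>carrier (ver F). \<forall>g\<in>carrier (hor F). act F g w = act F g v \<otimes>\<^bsub>hor F\<^esub> h"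

definition finite_forest_alg :: "('h, 'v) forest_alg \<Rightarrow> bool" where
  "finite_forest_alg F \<longleftrightarrow> finite (carrier (hor F)) \<and> finite (carrier (ver F))"

text \<open>\<^const>\<open>hom\<close> does not require the preservation of the identity.\<close>

definition monoid_hom :: "'a monoid \<Rightarrow> 'b monoid \<Rightarrow> ('a \<Rightarrow> 'b) set" where
  "monoid_hom M N = {f \<in> hom M N. f \<one>\<^bsub>M\<^esub> = \<one>\<^bsub>N\<^esub>}"

definition forest_alg_hom ::
  "('h, 'v) forest_alg \<Rightarrow> ('k, 'w) forest_alg \<Rightarrow> (('h \<Rightarrow> 'k) \<times> ('v \<Rightarrow> 'w)) set" where
  "forest_alg_hom F G = {(\<alpha>, \<beta>). \<alpha> \<in> monoid_hom (hor F) (hor G) \<and> \<beta> \<in> monoid_hom (ver F) (ver G) \<and>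
     (\<forall>h\<in>carrier (hor F). \<forall>v\<in>carrier (ver F). \<alpha> (act F h v) = act G (\<alpha> h) (\<beta> v))}"


section \<open>Forests, contexts and the free forest algebra\<close>

datatype 'a tree = Node (label: 'a) (children: "'a tree multiset")

type_synonym 'a forest = "'a tree multiset"

text \<open>\<open>CHole f\<close> is the context \<open>\<box> + f\<close>; \<open>CNode f a p\<close> is \<open>f + a(p)\<close>, with the hole below the root
  labelled \<open>a\<close>. Every forest with one leaf replaced by a hole has exactly one such representation.\<close>

datatype 'a ctx = CHole "'a forest" | CNode "'a forest" 'a "'a ctx"

primrec subst :: "'a forest \<Rightarrow> 'a ctx \<Rightarrow> 'a forest" where
  "subst s (CHole f) = s + f"
| "subst s (CNode f a p) = f + {#Node a (subst s p)#}"

primrec ctx_add :: "'a ctx \<Rightarrow> 'a forest \<Rightarrow> 'a ctx" where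
  "ctx_add (CHole f) g = CHole (f + g)"
| "ctx_add (CNode f a p) g = CNode (f + g) a p"

text \<open>\<open>ctx_comp p q\<close> substitutes \<open>p\<close> into the hole of \<open>q\<close>.\<close>

primrec ctx_comp :: "'a ctx \<Rightarrow> 'a ctx \<Rightarrow> 'a ctx" where
  "ctx_comp p (CHole f) = ctx_add p f"
| "ctx_comp p (CNode f a q) = CNode f a (ctx_comp p q)"

definition free_forest_alg :: "('a forest, 'a ctx) forest_alg" where
  "free_forest_alg =
    \<lparr>hor = \<lparr>carrier = UNIV, mult = (+), one = {#}\<rparr>,
     ver = \<lparr>carrier = UNIV, mult = ctx_comp, one = CHole {#}\<rparr>,
     act = subst\<rparr>"

lemma subst_add: "subst s (ctx_add p f) = subst s p + f"
  by (cases p) (auto simp: ac_simps)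

lemma subst_comp: "subst s (ctx_comp p q) = subst (subst s p) q"
  by (induction q) (auto simp: subst_add)

lemma ctx_add_add: "ctx_add (ctx_add p f) g = ctx_add p (f + g)"
  by (cases p) (auto simp: ac_simps)

lemma ctx_comp_add: "ctx_comp p (ctx_add q f) = ctx_add (ctx_comp p q) f"
  by (cases q) (auto simp: ctx_add_add)

lemma ctx_comp_assoc: "ctx_comp (ctx_comp p q) r = ctx_comp p (ctx_comp q r)"
  by (induction r) (auto simp: ctx_comp_add)

lemma ctx_comp_one: "ctx_comp (CHole {#}) p = p"
  by (induction p) auto

lemma ctx_add_zero: "ctx_add p {#} = p"
  by (cases p) auto

lemma subst_inject: "subst s p = subst t p \<Longrightarrow> s = t"
  by (induction p) auto

lemma subst_faithful: "(\<And>s. subst s p = subst s q) \<Longrightarrow> p = q"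
proof (induction p arbitrary: q)
  case (CHole f)
  show ?case
  proof (cases q)
    case (CHole g)
    then show ?thesis using CHole.prems[of "{#}"] by simp
  next
    case (CNode g b q')
    have "s + f = g + {#Node b (subst s q')#}" for s
      using CHole.prems[of s] CNode by simp
    from this[of "{#}"] this[of "{#undefined#}"]
    have "size ({#undefined, Node b (subst {#} q')#} + g) = size ({#Node b (subst {#undefined#} q')#} + g)"
      by (simp add: ac_simps)
    then show ?thesis by simp
  qed
next
  case (CNode f a p)
  show ?case
  proof (cases q)
    case (CHole g)
    have "s + g = f + {#Node a (subst s p)#}" for s
      using CNode.prems[of s] CHole by simp
    from this[of "{#}"] this[of "{#undefined#}"]
    have "size ({#undefined, Node a (subst {#} p)#} + f) = size ({#Node a (subst {#undefined#} p)#} + f)"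
      by (simp add: ac_simps)
    then show ?thesis by simp
  next
    case q: (CNode g b q')
    define P where "P s = Node a (subst s p)" for s
    define Q where "Q s = Node b (subst s q')" for s
    have eq: "f + {#P s#} = g + {#Q s#}" for s
      using CNode.prems[of s] q by (simp add: P_def Q_def)
    have "P {#} = Q {#}"
    proof (rule ccontr)
      assume ne: "P {#} \<noteq> Q {#}"
      have "(f + {#P s#}) + (g + {#Q {#}#}) = (g + {#Q s#}) + (f + {#P {#}#})" for s
        using eq[of s] eq[of "{#}"] by simp
      then have "(f + g) + {#P s, Q {#}#} = (f + g) + {#Q s, P {#}#}" for s
        by (simp add: ac_simps)
      then have "{#P s, Q {#}#} = {#Q s, P {#}#}" for s
        by simp
      then have "P s = P {#}" for s
        using ne by (metis add_eq_conv_ex add_mset_eq_single add_mset_eq_singleton_iff)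
      then show False
        using subst_inject by (metis P_def empty_not_add_mset tree.inject)
    qed
    then have fg: "f = g" using eq[of "{#}"] by simp
    then have "P s = Q s" for s using eq[of s] by simp
    then have "a = b" and "\<And>s. subst s p = subst s q'" by (auto simp: P_def Q_def)
    then show ?thesis using CNode.IH fg q by simp
  qed
qed

lemma forest_algebra_free: "forest_algebra free_forest_alg"
proof -
  have "comm_monoid (hor free_forest_alg)"
    by (rule comm_monoidI) (auto simp: free_forest_alg_def ac_simps)
  moreover have "monoid (ver free_forest_alg)"
    by (rule monoidI) (auto simp: free_forest_alg_def ctx_comp_assoc ctx_comp_one ctx_add_zero)
  ultimately show ?thesis
    by (auto simp: forest_algebra_def free_forest_alg_def subst_comp subst_add
        intro: subst_faithful intro!: exI[of _ "ctx_add _ _"])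
qed


section \<open>Regular forest languages and the syntactic forest algebra\<close>

text \<open>A finite forest algebra is isomorphic to one whose carriers are sets of natural numbers, so
  quantifying over algebras of type \<open>(nat, nat) forest_alg\<close> covers all of them; see
  \<open>regular_forest_langI\<close> below.\<close>

definition recognizes :: "('h, 'v) forest_alg \<Rightarrow> 'a forest set \<Rightarrow> bool" where
  "recognizes F L \<longleftrightarrow> (\<exists>(\<alpha>, \<beta>) \<in> forest_alg_hom free_forest_alg F.
     \<exists>X \<subseteq> carrier (hor F). L = \<alpha> -` X)"

definition regular_forest_lang :: "'a forest set \<Rightarrow> bool" where
  "regular_forest_lang L \<longleftrightarrow>
     (\<exists>F :: (nat, nat) forest_alg. forest_algebra F \<and> finite_forest_alg F \<and> recognizes F L)"

lemma regular_forest_langI: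
  fixes F :: "('h, 'v) forest_alg" and L :: "'a forest set"
  assumes "forest_algebra F" "finite_forest_alg F" "recognizes F L"
  shows "regular_forest_lang L"
proof -
  interpret F: forest_algebra F by fact
  interpret H: comm_monoid "hor F" by (rule F.comm_monoid_hor)
  interpret V: Group.monoid "ver F" by (rule F.monoid_ver)
  define H V where "H = carrier (hor F)" and "V = carrier (ver F)"
  have "finite H" "finite V"
    using assms(2) by (auto simp: finite_forest_alg_def H_def V_def)
  then obtain i :: "'h \<Rightarrow> nat" and j :: "'v \<Rightarrow> nat" where i: "inj_on i H" and j: "inj_on j V"
    using finite_imp_inj_to_nat_seg by metis
  define i' j' where "i' = inv_into H i" and "j' = inv_into V j"
  have ij [simp]: "x \<in> H \<Longrightarrow> i' (i x) = x" "y \<in> V \<Longrightarrow> j' (j y) = y" for x y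
    using i j by (auto simp: i'_def j'_def)
  have cl [simp]: "x \<in> H \<Longrightarrow> y \<in> H \<Longrightarrow> x \<otimes>\<^bsub>hor F\<^esub> y \<in> H" "\<one>\<^bsub>hor F\<^esub> \<in> H"
    "v \<in> V \<Longrightarrow> w \<in> V \<Longrightarrow> v \<otimes>\<^bsub>ver F\<^esub> w \<in> V" "\<one>\<^bsub>ver F\<^esub> \<in> V"
    "x \<in> H \<Longrightarrow> v \<in> V \<Longrightarrow> act F x v \<in> H" for x y v w
    by (auto simp: H_def V_def F.act_closed)
  define G where "G =
    \<lparr>hor = \<lparr>carrier = i ` H, mult = (\<lambda>x y. i (i' x \<otimes>\<^bsub>hor F\<^esub> i' y)), one = i \<one>\<^bsub>hor F\<^esub>\<rparr>,
     ver = \<lparr>carrier = j ` V, mult = (\<lambda>x y. j (j' x \<otimes>\<^bsub>ver F\<^esub> j' y)), one = j \<one>\<^bsub>ver F\<^esub>\<rparr>,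
     act = (\<lambda>x v. i (act F (i' x) (j' v)))\<rparr>"
  have "comm_monoid (hor G)"
    by (rule comm_monoidI) (auto simp: G_def H_def[symmetric] H.m_ac[folded H_def]
      H.l_one[folded H_def])
  moreover have "Group.monoid (ver G)"
    by (rule monoidI) (auto simp: G_def V.m_assoc[folded V_def] V.l_one[folded V_def] V.r_one[folded V_def])
  moreover have "v = w" if "v \<in> V" "w \<in> V" "\<And>h. h \<in> H \<Longrightarrow> i (act F h v) = i (act F h w)" for v w
    using that inj_onD[OF i] by (intro F.act_faithful[folded H_def V_def]) auto
  moreover have "\<exists>w\<in>V. \<forall>g\<in>H. act F g w = act F g v \<otimes>\<^bsub>hor F\<^esub> h" if "v \<in> V" "h \<in> H" for v h
    using that F.act_insert[folded H_def V_def] by blast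
  ultimately have "forest_algebra G"
    unfolding forest_algebra_def
    by (fastforce simp: G_def F.act_one[folded H_def] F.act_mult[folded H_def V_def])
  moreover have "finite_forest_alg G"
    using \<open>finite H\<close> \<open>finite V\<close> by (simp add: finite_forest_alg_def G_def)
  moreover have "recognizes G L"
  proof -
    obtain \<alpha> :: "'a forest \<Rightarrow> 'h" and \<beta> X where hom: "(\<alpha>, \<beta>) \<in> forest_alg_hom free_forest_alg F"
      and X: "X \<subseteq> H" "L = \<alpha> -` X"
      using assms(3) by (auto simp: recognizes_def H_def)
    have in_HV: "\<alpha> s \<in> H" "\<beta> p \<in> V" for s p
      using hom by (auto simp: forest_alg_hom_def monoid_hom_def hom_def free_forest_alg_def H_def V_def)
    have "(i \<circ> \<alpha>, j \<circ> \<beta>) \<in> forest_alg_hom free_forest_alg G"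
      using hom in_HV
      by (auto simp: forest_alg_hom_def monoid_hom_def hom_def free_forest_alg_def G_def)
    moreover have "i ` X \<subseteq> carrier (hor G)" using X by (auto simp: G_def)
    moreover have "L = (i \<circ> \<alpha>) -` (i ` X)"
      by (simp only: X(2) vimage_def o_apply inj_on_image_mem_iff[OF i in_HV(1) X(1)])
    ultimately show ?thesis by (auto simp: recognizes_def intro!: bexI[of _ "(i \<circ> \<alpha>, j \<circ> \<beta>)"])
  qed
  ultimately show ?thesis by (auto simp: regular_forest_lang_def)
qed

definition syn_cong_hor :: "'a forest set \<Rightarrow> ('a forest \<times> 'a forest) set" where
  "syn_cong_hor L = {(s, t). \<forall>p. subst s p \<in> L \<longleftrightarrow> subst t p \<in> L}"

definition syn_cong_ver :: "'a forest set \<Rightarrow> ('a ctx \<times> 'a ctx) set" where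
  "syn_cong_ver L = {(p, q). \<forall>s. (subst s p, subst s q) \<in> syn_cong_hor L}"

definition syntactic_forest_alg :: "'a forest set \<Rightarrow> ('a forest set, 'a ctx set) forest_alg" where
  "syntactic_forest_alg L =
    \<lparr>hor = \<lparr>carrier = UNIV // syn_cong_hor L,
            mult = (\<lambda>S T. \<Union>s\<in>S. \<Union>t\<in>T. syn_cong_hor L `` {s + t}),
            one = syn_cong_hor L `` {{#}}\<rparr>,
     ver = \<lparr>carrier = UNIV // syn_cong_ver L,
            mult = (\<lambda>P Q. \<Union>p\<in>P. \<Union>q\<in>Q. syn_cong_ver L `` {ctx_comp p q}),
            one = syn_cong_ver L `` {CHole {#}}\<rparr>,
     act = (\<lambda>S P. \<Union>s\<in>S. \<Union>p\<in>P. syn_cong_hor L `` {subst s p})\<rparr>"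

lemma equiv_syn_cong_hor: "equiv UNIV (syn_cong_hor L)"
  by (auto simp: equiv_def refl_on_def sym_def trans_def syn_cong_hor_def)

lemma equiv_syn_cong_ver: "equiv UNIV (syn_cong_ver L)"
  by (auto simp: equiv_def refl_on_def sym_def trans_def syn_cong_hor_def syn_cong_ver_def)

lemma syn_cong_subst:
  assumes "(s, t) \<in> syn_cong_hor L" "(p, q) \<in> syn_cong_ver L"
  shows "(subst s p, subst t q) \<in> syn_cong_hor L"
  using assms by (simp add: syn_cong_hor_def syn_cong_ver_def flip: subst_comp)

lemma syn_cong_add:
  assumes "(s, s') \<in> syn_cong_hor L" "(t, t') \<in> syn_cong_hor L"
  shows "(s + t, s' + t') \<in> syn_cong_hor L"
proof -
  have *: "(u + w, v + w) \<in> syn_cong_hor L" if "(u, v) \<in> syn_cong_hor L" for u v w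
  proof -
    have "(CHole w, CHole w) \<in> syn_cong_ver L" by (simp add: syn_cong_ver_def syn_cong_hor_def)
    from syn_cong_subst[OF that this] show ?thesis by simp
  qed
  from *[OF assms(1), of t] *[OF assms(2), of s'] show ?thesis
    using equiv_syn_cong_hor[of L] by (metis add.commute equivE transD)
qed

lemma syn_cong_comp:
  assumes "(p, p') \<in> syn_cong_ver L" "(q, q') \<in> syn_cong_ver L"
  shows "(ctx_comp p q, ctx_comp p' q') \<in> syn_cong_ver L"
  using assms syn_cong_subst by (fastforce simp: syn_cong_ver_def subst_comp)

lemma syntactic_carrier:
  "carrier (hor (syntactic_forest_alg L)) = UNIV // syn_cong_hor L"
  "carrier (ver (syntactic_forest_alg L)) = UNIV // syn_cong_ver L"
  by (simp_all add: syntactic_forest_alg_def)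

lemma syntactic_one:
  "\<one>\<^bsub>hor (syntactic_forest_alg L)\<^esub> = syn_cong_hor L `` {{#}}"
  "\<one>\<^bsub>ver (syntactic_forest_alg L)\<^esub> = syn_cong_ver L `` {CHole {#}}"
  by (simp_all add: syntactic_forest_alg_def)

lemma syntactic_add:
  "syn_cong_hor L `` {s} \<otimes>\<^bsub>hor (syntactic_forest_alg L)\<^esub> syn_cong_hor L `` {t} = syn_cong_hor L `` {s + t}"
  unfolding syntactic_forest_alg_def forest_alg.simps monoid.simps
  by (rule UN_equiv_class2[OF equiv_syn_cong_hor equiv_syn_cong_hor])
    (auto intro!: congruent2I' equiv_class_eq[OF equiv_syn_cong_hor] syn_cong_add)

lemma syntactic_comp:
  "syn_cong_ver L `` {p} \<otimes>\<^bsub>ver (syntactic_forest_alg L)\<^esub> syn_cong_ver L `` {q} = syn_cong_ver L `` {ctx_comp p q}"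
  unfolding syntactic_forest_alg_def forest_alg.simps monoid.simps
  by (rule UN_equiv_class2[OF equiv_syn_cong_ver equiv_syn_cong_ver])
    (auto intro!: congruent2I' equiv_class_eq[OF equiv_syn_cong_ver] syn_cong_comp)

lemma syntactic_act:
  "act (syntactic_forest_alg L) (syn_cong_hor L `` {s}) (syn_cong_ver L `` {p}) = syn_cong_hor L `` {subst s p}"
  unfolding syntactic_forest_alg_def forest_alg.simps monoid.simps
  by (rule UN_equiv_class2[OF equiv_syn_cong_hor equiv_syn_cong_ver])
    (auto intro!: congruent2I' equiv_class_eq[OF equiv_syn_cong_hor] syn_cong_subst)

lemmas syntactic_simps = syntactic_carrier syntactic_one syntactic_add syntactic_comp syntactic_act

lemma forest_algebra_syntactic: "forest_algebra (syntactic_forest_alg L)"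
proof (rule forest_algebra.intro)
  show "comm_monoid (hor (syntactic_forest_alg L))"
    by (rule comm_monoidI, unfold syntactic_carrier syntactic_one)
      ((elim quotientE)?, simp add: syntactic_add quotientI ac_simps)+
  show "Group.monoid (ver (syntactic_forest_alg L))"
    by (rule monoidI, unfold syntactic_carrier syntactic_one)
      ((elim quotientE)?, simp add: syntactic_comp quotientI ctx_comp_assoc ctx_comp_one ctx_add_zero)+
next
  fix v w
  assume "v \<in> carrier (ver (syntactic_forest_alg L))" "w \<in> carrier (ver (syntactic_forest_alg L))"
  then obtain p q where pq: "v = syn_cong_ver L `` {p}" "w = syn_cong_ver L `` {q}"
    by (auto simp: syntactic_carrier elim!: quotientE)
  assume "\<And>h. h \<in> carrier (hor (syntactic_forest_alg L))
    \<Longrightarrow> act (syntactic_forest_alg L) h v = act (syntactic_forest_alg L) h w"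
  then have "syn_cong_hor L `` {subst s p} = syn_cong_hor L `` {subst s q}" for s
    by (metis pq syntactic_act syntactic_carrier(1) quotientI UNIV_I)
  then show "v = w"
    using equiv_class_eq[OF equiv_syn_cong_ver] eq_equiv_class[OF _ equiv_syn_cong_hor]
    by (fastforce simp: pq syn_cong_ver_def)
next
  fix v h
  assume "v \<in> carrier (ver (syntactic_forest_alg L))" "h \<in> carrier (hor (syntactic_forest_alg L))"
  then obtain p s where ps: "v = syn_cong_ver L `` {p}" "h = syn_cong_hor L `` {s}"
    by (auto simp: syntactic_carrier elim!: quotientE)
  have "syn_cong_ver L `` {ctx_add p s} \<in> carrier (ver (syntactic_forest_alg L))"
    by (simp add: syntactic_carrier quotientI)
  moreover have "act (syntactic_forest_alg L) g (syn_cong_ver L `` {ctx_add p s})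
      = act (syntactic_forest_alg L) g v \<otimes>\<^bsub>hor (syntactic_forest_alg L)\<^esub> h"
    if "g \<in> carrier (hor (syntactic_forest_alg L))" for g
    using that unfolding syntactic_carrier ps
    by (elim quotientE) (simp add: syntactic_simps subst_add)
  ultimately show "\<exists>w\<in>carrier (ver (syntactic_forest_alg L)). \<forall>g\<in>carrier (hor (syntactic_forest_alg L)).
      act (syntactic_forest_alg L) g w
      = act (syntactic_forest_alg L) g v \<otimes>\<^bsub>hor (syntactic_forest_alg L)\<^esub> h"
    by blast
qed (unfold syntactic_carrier, (elim quotientE, simp add: syntactic_simps quotientI subst_comp ctx_add_zero)+)


section \<open>Definite types and local testability\<close>

datatype 'a dtype = DZero | DType 'a "'a dtype fset"

text \<open>A node enters through the subtree rooted at it, which determines its definite types.\<close>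

primrec def_type :: "nat \<Rightarrow> 'a tree \<Rightarrow> 'a dtype" where
  "def_type 0 t = DZero"
| "def_type (Suc k) t = DType (label t) (def_type k |`| Abs_fset (set_mset (children t)))"

primrec tree_nodes :: "'a tree \<Rightarrow> 'a tree set" where
  "tree_nodes (Node a f) = insert (Node a f) (\<Union> (set_mset (image_mset tree_nodes f)))"

definition nodes :: "'a forest \<Rightarrow> 'a tree set" where
  "nodes s = (\<Union>t\<in>set_mset s. tree_nodes t)"

text \<open>Intended for \<open>k > 0\<close>.\<close>

definition loc_equiv :: "nat \<Rightarrow> ('a forest \<times> 'a forest) set" where
  "loc_equiv k = {(s, t). def_type (k - 1) ` set_mset s = def_type (k - 1) ` set_mset t \<and>
     def_type k ` nodes s = def_type k ` nodes t}"

definition k_locally_testable :: "nat \<Rightarrow> 'a forest set \<Rightarrow> bool" where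
  "k_locally_testable k L \<longleftrightarrow> k > 0 \<and> (\<exists>C \<subseteq> UNIV // loc_equiv k. L = \<Union>C)"

definition locally_testable :: "'a forest set \<Rightarrow> bool" where
  "locally_testable L \<longleftrightarrow> (\<exists>k. k_locally_testable k L)"

lemma def_type_Suc_Node: "def_type (Suc k) (Node a f) =
    DType a (Abs_fset (def_type k ` set_mset f))"
  by (simp add: fimage_def Abs_fset_inverse)

end

theory Submission
  imports Defs
begin

text \<open>Since types record only sets of types of children, the horizontal monoid of \<open>L\<close> is idempotent.
  Let \<open>R\<^sub>m\<close> be the set of pairs of elements of \<open>H\<^sub>L\<close> that are represented by forests with the same
  \<open>m\<close>-definite types of roots. Idempotency makes \<open>R\<^sub>m\<^sub>+\<^sub>1\<close> a function of \<open>R\<^sub>m\<close>, so this decreasing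
  chain of subsets of \<open>H\<^sub>L \<times> H\<^sub>L\<close> is constant from \<open>m = |H\<^sub>L|\<^sup>2\<close> on. Hence two trees with the same
  \<open>|H\<^sub>L|\<^sup>2\<close>-definite type can be replaced by syntactically equivalent forests that agree with
  each other to any prescribed depth, where the local testability of \<open>L\<close> applies. In this way, if every
  root and node type of \<open>t\<close> occurs in \<open>s\<close>, copies of subtrees of \<open>t\<close>, built from the leaves upwards, can be
  inserted into a forest containing \<open>s\<close> as a summand. This gives \<open>s \<approx> s + t\<close>, and by symmetry
  \<open>s \<approx> t\<close>.\<close>

section \<open>Types of roots and nodes\<close>

definition root_types :: "nat \<Rightarrow> 'a forest \<Rightarrow> 'a dtype set" where
  "root_types k s = def_type k ` set_mset s"

definition node_types :: "nat \<Rightarrow> 'a forest \<Rightarrow> 'a dtype set" where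
  "node_types k s = def_type k ` nodes s"

lemma root_types_simps [simp]:
  "root_types k {#} = {}"
  "root_types k (s + t) = root_types k s \<union> root_types k t"
  "root_types k (add_mset x s) = insert (def_type k x) (root_types k s)"
  by (auto simp: root_types_def)

lemma node_types_simps [simp]:
  "node_types k {#} = {}"
  "node_types k (s + t) = node_types k s \<union> node_types k t"
  "node_types k (add_mset (Node a f) s) =
     insert (def_type k (Node a f)) (node_types k f \<union> node_types k s)"
  by (auto simp: node_types_def nodes_def)

lemma node_types_mem: "x \<in># s \<Longrightarrow> node_types k {#x#} \<subseteq> node_types k s"
  unfolding node_types_def nodes_def by (intro image_mono) auto

lemma loc_equiv_iff:
  "(s, t) \<in> loc_equiv (Suc k) \<longleftrightarrow>
     root_types k s = root_types k t \<and> node_types (Suc k) s = node_types (Suc k) t"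
  by (simp add: loc_equiv_def root_types_def node_types_def)

lemma equiv_loc_equiv: "equiv UNIV (loc_equiv k)"
  by (auto simp: equiv_def refl_on_def sym_def trans_def loc_equiv_def)

lemma k_locally_testable_iff:
  "k_locally_testable k L \<longleftrightarrow> k > 0 \<and> (\<forall>s t. (s, t) \<in> loc_equiv k \<longrightarrow> s \<in> L \<longrightarrow> t \<in> L)"
proof (intro iffI conjI allI impI)
  assume "k_locally_testable k L"
  then obtain C where C: "k > 0" "C \<subseteq> UNIV // loc_equiv k" "L = \<Union> C"
    by (auto simp: k_locally_testable_def)
  then show "k > 0" by simp
  fix s t assume st: "(s, t) \<in> loc_equiv k" "s \<in> L"
  then obtain S where "S \<in> C" "s \<in> S"
    using C(3) by blast
  then have "t \<in> S"
    using in_quotient_imp_closed[OF equiv_loc_equiv _ _ st(1)] C(2) by blast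
  then show "t \<in> L"
    using \<open>S \<in> C\<close> C(3) by blast
next
  assume *: "k > 0 \<and> (\<forall>s t. (s, t) \<in> loc_equiv k \<longrightarrow> s \<in> L \<longrightarrow> t \<in> L)"
  have "L = \<Union> ((\<lambda>s. loc_equiv k `` {s}) ` L)"
    using * equiv_class_self[OF equiv_loc_equiv[of k]] by auto
  moreover have "(\<lambda>s. loc_equiv k `` {s}) ` L \<subseteq> UNIV // loc_equiv k"
    by (auto intro: quotientI)
  ultimately show "k_locally_testable k L"
    using * unfolding k_locally_testable_def by metis
qed

text \<open>From here on, types of positive depth are compared through this equivalence, so later
  steps remove \<open>def_type.simps\<close> from the simplifier.\<close>

lemma def_type_Suc_eq_iff:
  "def_type (Suc k) (Node a f) = def_type (Suc k) (Node b g) \<longleftrightarrow> a = b \<and> root_types k f = root_types k g"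
  unfolding def_type_Suc_Node root_types_def by (simp add: Abs_fset_inject)

lemma def_type_antimono: "def_type (Suc k) x = def_type (Suc k) y \<Longrightarrow> def_type k x = def_type k y"
proof (induction k arbitrary: x y)
  case (Suc k)
  obtain a f b g where xy: "x = Node a f" "y = Node b g"
    by (metis tree.exhaust)
  have "a = b" and "root_types (Suc k) f = root_types (Suc k) g"
    using Suc.prems unfolding xy def_type_Suc_eq_iff by auto
  moreover have "root_types k u \<subseteq> root_types k v" if "root_types (Suc k) u = root_types (Suc k) v" for u v :: "'a forest"
  proof
    fix z assume "z \<in> root_types k u"
    then obtain w where w: "w \<in># u" "z = def_type k w"
      by (auto simp: root_types_def)
    then have "def_type (Suc k) w \<in> root_types (Suc k) v"
      using that unfolding root_types_def by blast
    then obtain w' where w': "w' \<in># v" "def_type (Suc k) w = def_type (Suc k) w'"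
      unfolding root_types_def by blast
    then show "z \<in> root_types k v"
      unfolding root_types_def w(2) Suc.IH[OF w'(2)] by blast
  qed
  ultimately show ?case
    unfolding xy def_type_Suc_eq_iff by blast
qed simp

lemma root_types_antimono:
  assumes "root_types (Suc k) s = root_types (Suc k) t"
  shows "root_types k s = root_types k t"
proof -
  \<comment> \<open>A dummy root turns the forests into trees.\<close>
  have "def_type (Suc (Suc k)) (Node undefined s) = def_type (Suc (Suc k)) (Node undefined t)"
    using assms by (simp only: def_type_Suc_eq_iff)
  from def_type_antimono[OF this] show ?thesis
    by (simp only: def_type_Suc_eq_iff)
qed

text \<open>A parent sees its children only to depth \<open>k\<close>, so every node of the context
  keeps its \<open>Suc k\<close>-type. The set \<open>C\<close> collects these types; sharing it
  lets the results be compared even if \<open>s\<close> and \<open>t\<close> have different node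
  types.\<close>

lemma types_subst:
  assumes "root_types k s = root_types k t"
  shows "root_types k (subst s p) = root_types k (subst t p) \<and>
    (\<exists>C. node_types (Suc k) (subst s p) = C \<union> node_types (Suc k) s \<and>
         node_types (Suc k) (subst t p) = C \<union> node_types (Suc k) t)"
proof (induction p)
  case (CHole f)
  show ?case using assms by (auto intro!: exI[of _ "node_types (Suc k) f"])
next
  case (CNode f a p)
  then obtain C where C: "root_types k (subst s p) = root_types k (subst t p)"
    "node_types (Suc k) (subst s p) = C \<union> node_types (Suc k) s"
    "node_types (Suc k) (subst t p) = C \<union> node_types (Suc k) t"
    by blast
  then have eq: "def_type (Suc k) (Node a (subst s p)) = def_type (Suc k) (Node a (subst t p))"
    by (simp only: def_type_Suc_eq_iff simp_thms)
  show ?case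
    using def_type_antimono[OF eq] eq C
    by (auto simp del: def_type.simps
        intro!: exI[of _ "node_types (Suc k) f \<union> insert (def_type (Suc k) (Node a (subst t p))) C"])
qed

lemma node_as_subst: "x \<in> nodes s \<Longrightarrow> \<exists>q. s = subst {#x#} q"
proof -
  have summand: "\<exists>q. s = subst {#x#} q" if "{#u#} = subst {#x#} q" "u \<in># s" for s x u and q :: "'a ctx"
    using that by (intro exI[of _ "ctx_add q (s - {#u#})"]) (simp add: subst_add flip: that(1))
  have "\<exists>q. {#u#} = subst {#x#} q" if "x \<in> tree_nodes u" for x u :: "'a tree"
    using that
  proof (induction u)
    case (Node a f)
    show ?case
    proof (cases "x = Node a f")
      case True
      then show ?thesis by (intro exI[of _ "CHole {#}"]) simp
    next
      case False
      then obtain u where "u \<in># f" "x \<in> tree_nodes u"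
        using Node.prems by auto
      with Node.IH summand obtain q where "f = subst {#x#} q"
        by metis
      then show ?thesis by (intro exI[of _ "CNode {#} a q"]) simp
    qed
  qed
  with summand show "x \<in> nodes s \<Longrightarrow> \<exists>q. s = subst {#x#} q"
    unfolding nodes_def by blast
qed


section \<open>Pairs of syntactic classes with a common definite type\<close>

text \<open>With the parameter \<open>Suc l\<close>, root types have depth \<open>l\<close> and node
  types depth \<open>Suc l\<close>. One implication suffices because \<open>loc_equiv\<close> is
  symmetric.\<close>

locale loc_testable_lang =
  fixes L :: "'a forest set" and l :: nat
  assumes saturated: "(s, t) \<in> loc_equiv (Suc l) \<Longrightarrow> s \<in> L \<Longrightarrow> t \<in> L"
begin

definition val :: "'a forest \<Rightarrow> 'a forest set" where
  "val s = syn_cong_hor L `` {s}"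

lemma val_eq_iff: "val s = val t \<longleftrightarrow> (s, t) \<in> syn_cong_hor L"
  unfolding val_def by (rule eq_equiv_class_iff[OF equiv_syn_cong_hor]) simp_all

lemma val_add: "val s = val s' \<Longrightarrow> val t = val t' \<Longrightarrow> val (s + t) = val (s' + t')"
  unfolding val_eq_iff by (rule syn_cong_add)

lemma val_subst: "val s = val t \<Longrightarrow> val (subst s p) = val (subst t p)"
  unfolding val_eq_iff using equiv_syn_cong_ver[of L]
  by (intro syn_cong_subst) (auto simp: equiv_def refl_on_def)

text \<open>Every context preserves local equivalence, and \<open>L\<close> is saturated under it.
  Local testability of \<open>L\<close> enters only here.\<close>

lemma val_loc_equiv:
  assumes "root_types l s = root_types l t" "node_types (Suc l) s = node_types (Suc l) t"
  shows "val s = val t"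
proof -
  have "(subst s p, subst t p) \<in> loc_equiv (Suc l)" for p
    using types_subst[OF assms(1), of p] assms(2) by (auto simp: loc_equiv_iff)
  moreover have "(subst t p, subst s p) \<in> loc_equiv (Suc l)" for p
    using types_subst[OF assms(1), of p] assms(2) by (auto simp: loc_equiv_iff)
  ultimately show ?thesis
    unfolding val_eq_iff syn_cong_hor_def using saturated by blast
qed

lemma val_idem: "val (s + s) = val s"
  by (rule val_loc_equiv) auto

lemma val_absorb:
  assumes "\<And>x. x \<in># t \<Longrightarrow> val (s + {#x#}) = val s"
  shows "val (s + t) = val s"
  using assms
proof (induction t)
  case (add x t)
  have "val (s + add_mset x t) = val ((s + t) + {#x#})"
    by simp
  also have "\<dots> = val (s + {#x#})"
    using add by (intro val_add) auto
  finally show ?case using add.prems by simp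
qed simp

lemma val_absorb_mem:
  assumes "\<And>x. x \<in># t \<Longrightarrow> \<exists>y \<in># s. val {#x#} = val {#y#}"
  shows "val (s + t) = val s"
proof (rule val_absorb)
  fix x assume "x \<in># t"
  then obtain y s' where y: "val {#x#} = val {#y#}" "s = s' + {#y#}"
    using assms by (metis add_mset_add_single mset_add)
  have "val (s + {#x#}) = val (s' + ({#y#} + {#y#}))"
    using val_add[OF refl y(1), of s] y(2) by simp
  also have "\<dots> = val s"
    unfolding y(2) by (intro val_add val_idem refl)
  finally show "val (s + {#x#}) = val s" .
qed

text \<open>Each of \<open>s\<close> and \<open>t\<close> absorbs the other, so both have the value
  of \<open>s + t\<close>.\<close>

lemma val_eqI:
  assumes "\<And>x. x \<in># s \<Longrightarrow> \<exists>y \<in># t. val {#x#} = val {#y#}"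
    and "\<And>y. y \<in># t \<Longrightarrow> \<exists>x \<in># s. val {#y#} = val {#x#}"
  shows "val s = val t"
proof -
  have "val (t + s) = val t" "val (s + t) = val s"
    by (rule val_absorb_mem, rule assms, assumption)+
  then show ?thesis by (simp add: add.commute)
qed

text \<open>This is \<open>R\<^sub>m\<close>: some representatives must agree in type, not
  all.\<close>

definition val_pairs :: "nat \<Rightarrow> ('a forest set \<times> 'a forest set) set" where
  "val_pairs m = {(val s, val t) |s t. root_types m s = root_types m t}"

lemma val_pairs_Suc_subset: "val_pairs (Suc m) \<subseteq> val_pairs m"
  unfolding val_pairs_def using root_types_antimono by blast

text \<open>Trees of equal \<open>Suc m\<close>-type have the same label and child forests related
  in \<open>val_pairs m\<close>, hence in \<open>val_pairs n\<close>, so the children can be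
  rechosen with equal \<open>n\<close>-types.\<close>

lemma val_pairs_step:
  assumes "val_pairs m \<subseteq> val_pairs n"
  shows "val_pairs (Suc m) \<subseteq> val_pairs (Suc n)"
proof -
  have "(val s, val t) \<in> val_pairs (Suc n)" if st: "root_types (Suc m) s = root_types (Suc m) t" for s t
  proof -
    \<comment> \<open>A tree may have several partners. Indexing the new forests by all matching
      pairs gives each match its own copies, harmless by idempotency.\<close>
    define P where "P = {(x, y). x \<in># s \<and> y \<in># t \<and> def_type (Suc m) x = def_type (Suc m) y}"
    have "finite P"
      by (rule finite_subset[of _ "set_mset s \<times> set_mset t"]) (auto simp: P_def)
    have node: "val {#Node c u#} = val {#Node c u'#}" if "val u = val u'" for c u u'
      using val_subst[OF that, of "CNode {#} c (CHole {#})"] by simp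
    have "\<exists>x' y'. val {#x'#} = val {#x#} \<and> val {#y'#} = val {#y#} \<and>
        def_type (Suc n) x' = def_type (Suc n) y'" if "(x, y) \<in> P" for x y
    proof -
      obtain a f b g where xy: "x = Node a f" "y = Node b g"
        by (metis tree.exhaust)
      have "a = b" and fg: "root_types m f = root_types m g"
        using that unfolding P_def xy by (auto simp only: def_type_Suc_eq_iff mem_Collect_eq case_prod_conv)
      from fg have "(val f, val g) \<in> val_pairs n"
        using assms unfolding val_pairs_def by blast
      then obtain f' g' where fg': "val f = val f'" "val g = val g'" "root_types n f' = root_types n g'"
        unfolding val_pairs_def by blast
      show ?thesis
        using node[OF fg'(1)] node[OF fg'(2)] fg'(3) \<open>a = b\<close> unfolding xy
        by (intro exI[of _ "Node a f'"] exI[of _ "Node b g'"]) (simp only: def_type_Suc_eq_iff simp_thms)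
    qed
    then have "\<forall>x y. \<exists>x' y'. (x, y) \<in> P \<longrightarrow> val {#x'#} = val {#x#} \<and> val {#y'#} = val {#y#} \<and>
        def_type (Suc n) x' = def_type (Suc n) y'"
      by blast
    then obtain X Y where "\<forall>x y. (x, y) \<in> P \<longrightarrow> val {#X x y#} = val {#x#} \<and>
        val {#Y x y#} = val {#y#} \<and> def_type (Suc n) (X x y) = def_type (Suc n) (Y x y)"
      unfolding choice_iff by blast
    then have XY: "val {#X x y#} = val {#x#}" "val {#Y x y#} = val {#y#}"
        "def_type (Suc n) (X x y) = def_type (Suc n) (Y x y)" if "(x, y) \<in> P" for x y
      using that by blast+
    define s' t' where "s' = image_mset (\<lambda>(x, y). X x y) (mset_set P)"
      and "t' = image_mset (\<lambda>(x, y). Y x y) (mset_set P)"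
    have s'_iff: "z \<in># s' \<longleftrightarrow> (\<exists>x y. (x, y) \<in> P \<and> z = X x y)" for z
      using \<open>finite P\<close> by (auto simp: s'_def)
    have t'_iff: "z \<in># t' \<longleftrightarrow> (\<exists>x y. (x, y) \<in> P \<and> z = Y x y)" for z
      using \<open>finite P\<close> by (auto simp: t'_def)
    have left: "\<exists>y. (x, y) \<in> P" if "x \<in># s" for x
      using that st unfolding root_types_def P_def by (simp del: def_type.simps) (metis imageE imageI)
    have right: "\<exists>x. (x, y) \<in> P" if "y \<in># t" for y
      using that st unfolding root_types_def P_def by (simp del: def_type.simps) (metis imageE imageI)
    have "val s = val s'"
    proof (rule val_eqI)
      show "\<exists>z\<in>#s'. val {#x#} = val {#z#}" if "x \<in># s" for x
        using left[OF that] XY(1) unfolding Bex_def s'_iff by metis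
      show "\<exists>x\<in>#s. val {#z#} = val {#x#}" if "z \<in># s'" for z
        using that XY(1) unfolding s'_iff by (auto simp: P_def simp del: def_type.simps)
    qed
    moreover have "val t = val t'"
    proof (rule val_eqI)
      show "\<exists>z\<in>#t'. val {#x#} = val {#z#}" if "x \<in># t" for x
        using right[OF that] XY(2) unfolding Bex_def t'_iff by metis
      show "\<exists>x\<in>#t. val {#z#} = val {#x#}" if "z \<in># t'" for z
        using that XY(2) unfolding t'_iff by (auto simp: P_def simp del: def_type.simps)
    qed
    moreover have "root_types (Suc n) s' = root_types (Suc n) t'"
    proof -
      have "root_types (Suc n) s' = (\<lambda>(x, y). def_type (Suc n) (X x y)) ` P"
        using \<open>finite P\<close> by (auto simp: s'_def root_types_def image_image case_prod_beta simp del: def_type.simps)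
      also have "\<dots> = (\<lambda>(x, y). def_type (Suc n) (Y x y)) ` P"
        by (rule image_cong) (use XY(3) in \<open>auto simp del: def_type.simps\<close>)
      also have "\<dots> = root_types (Suc n) t'"
        using \<open>finite P\<close> by (auto simp: t'_def root_types_def image_image case_prod_beta simp del: def_type.simps)
      finally show ?thesis .
    qed
    ultimately show ?thesis
      unfolding val_pairs_def by blast
  qed
  then show ?thesis
    unfolding val_pairs_def[of "Suc m"] by blast
qed

text \<open>The square counts the pairs in \<open>H\<^sub>L \<times> H\<^sub>L\<close>, which bounds
  the number of strict drops in the chain.\<close>

lemma val_pairs_stable:
  assumes fin: "finite (UNIV // syn_cong_hor L)"
  shows "val_pairs (card (UNIV // syn_cong_hor L) ^ 2) \<subseteq> val_pairs j"
proof -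
  define n where "n = card (UNIV // syn_cong_hor L) ^ 2"
  have sub: "val_pairs m \<subseteq> (UNIV // syn_cong_hor L) \<times> (UNIV // syn_cong_hor L)" for m
    by (auto simp: val_pairs_def val_def intro: quotientI)
  then have fin': "finite (val_pairs m)" for m
    using fin finite_subset by blast
  have "card (val_pairs 0) \<le> n"
    using card_mono[OF _ sub[of 0]] fin by (simp add: n_def card_cartesian_product power2_eq_square)
  \<comment> \<open>Strict drops at all indices from \<open>0\<close> to \<open>n\<close> would be
    \<open>n + 1\<close> drops, starting from at most \<open>n\<close> pairs.\<close>
  have "\<exists>m \<le> n. val_pairs m = val_pairs (Suc m)"
  proof (rule ccontr)
    assume "\<not> ?thesis"
    then have less: "card (val_pairs (Suc m)) < card (val_pairs m)" if "m \<le> n" for m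
      using that val_pairs_Suc_subset psubset_card_mono[OF fin'] by blast
    have "card (val_pairs m) + m \<le> n" if "m \<le> Suc n" for m
      using that
    proof (induction m)
      case (Suc m)
      then show ?case using less[of m] by simp
    qed (use \<open>card (val_pairs 0) \<le> n\<close> in simp)
    from this[of "Suc n"] show False by simp
  qed
  then obtain m where m: "m \<le> n" "val_pairs m = val_pairs (Suc m)"
    by blast
  have "val_pairs (m + i) \<subseteq> val_pairs (Suc (m + i))" for i
    by (induction i) (use m val_pairs_step in auto)
  then have "val_pairs m \<subseteq> val_pairs (m + i)" for i
    by (induction i) force+
  moreover have anti: "val_pairs (i + d) \<subseteq> val_pairs i" for i d
    by (induction d) (use val_pairs_Suc_subset in force)+
  \<comment> \<open>If \<open>j\<close> is at least \<open>m\<close>, the chain is constant from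
    \<open>m\<close> on; if \<open>j\<close> is smaller, \<open>anti\<close> suffices.\<close>
  ultimately show ?thesis
    unfolding n_def[symmetric] using m(1) by (metis le_add_diff_inverse nle_le subset_trans)
qed

end


section \<open>Insertion of subtrees\<close>

locale loc_testable_pairs = loc_testable_lang +
  fixes m :: nat
  assumes pairs: "val_pairs m \<subseteq> val_pairs l"
begin

text \<open>Trades agreement to depth \<open>m\<close> for agreement to depth \<open>l\<close>,
  where \<open>val_loc_equiv\<close> applies, by changing representatives. It is the only use of
  \<open>pairs\<close>.\<close>

lemma deepen:
  assumes "root_types m s = root_types m t"
  obtains s' t' where "val s' = val s" "val t' = val t" "root_types l s' = root_types l t'"
proof -
  have "(val s, val t) \<in> val_pairs l"
    using assms pairs unfolding val_pairs_def by blast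
  then obtain s' t' where "val s = val s'" "val t = val t'" "root_types l s' = root_types l t'"
    unfolding val_pairs_def by blast
  then show thesis using that by metis
qed

text \<open>Exchange \<open>x\<close> and \<open>y\<close> for representatives \<open>x'\<close> and
  \<open>y'\<close> that agree to depth \<open>l\<close>. Adding \<open>x'\<close> beside
  \<open>y'\<close> then creates no new type, since the nodes of \<open>x'\<close> already occur in
  \<open>subst x' q\<close>. Finally, exchange back.\<close>

lemma transfer_subtree:
  assumes "x \<in> nodes s" "def_type m x = def_type m y"
  shows "val (s + subst {#y#} p) = val (s + subst {#y, x#} p)"
proof -
  obtain q where q: "s = subst {#x#} q"
    using node_as_subst[OF assms(1)] by blast
  have "root_types m {#x#} = root_types m {#y#}"
    using assms(2) by simp
  then obtain x' y' where xy: "val x' = val {#x#}" "val y' = val {#y#}" "root_types l x' = root_types l y'"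
    by (rule deepen)
  have "val (s + subst {#y#} p) = val (subst x' q + subst y' p)"
    unfolding q by (intro val_add val_subst xy[symmetric])
  also have "\<dots> = val (subst x' q + subst (y' + x') p)"
  proof (rule val_loc_equiv)
    have "root_types l y' = root_types l (y' + x')"
      using xy(3) by simp
    note p = types_subst[OF this, of p]
    then show "root_types l (subst x' q + subst y' p) = root_types l (subst x' q + subst (y' + x') p)"
      by simp
    show "node_types (Suc l) (subst x' q + subst y' p) = node_types (Suc l) (subst x' q + subst (y' + x') p)"
      using p types_subst[OF refl, of l x' q] by auto
  qed
  also have "\<dots> = val (s + subst ({#y#} + {#x#}) p)"
    unfolding q by (intro val_add val_subst xy)
  finally show ?thesis by (simp add: add_mset_commute)
qed

text \<open>For deepened \<open>f'\<close> and \<open>g'\<close>, nodes labelled \<open>a\<close>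
  over \<open>f'\<close> and over \<open>g' + f'\<close> have the same type, and the descendants of
  the added node already occur.\<close>

lemma split_node:
  assumes "root_types m f = root_types m g"
  shows "val {#Node a (g + f)#} = val {#Node a (g + f), Node a f#}"
proof -
  have node: "val {#Node a u#} = val {#Node a u'#}" if "val u = val u'" for u u'
    using val_subst[OF that, of "CNode {#} a (CHole {#})"] by simp
  obtain f' g' where fg: "val f' = val f" "val g' = val g" "root_types l f' = root_types l g'"
    using deepen[OF assms] .
  have type: "def_type (Suc l) (Node a (g' + f')) = def_type (Suc l) (Node a f')"
    unfolding def_type_Suc_eq_iff using fg(3) by simp
  have "val {#Node a (g + f)#} = val {#Node a (g' + f')#}"
    by (intro node val_add fg[symmetric])
  also have "\<dots> = val ({#Node a (g' + f')#} + {#Node a f'#})"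
    using type def_type_antimono[OF type] by (intro val_loc_equiv) (auto simp del: def_type.simps)
  also have "\<dots> = val ({#Node a (g + f)#} + {#Node a f#})"
    by (intro node val_add fg)
  finally show ?thesis by (simp add: add_mset_commute)
qed

text \<open>The forest \<open>s\<close> is a reservoir. A node \<open>x\<close> of \<open>s\<close>
  with the \<open>Suc m\<close>-type of \<open>t\<close> is copied beside \<open>y\<close>, the
  children of \<open>t\<close> are inserted into the copy by induction, \<open>t\<close> is split
  off, and the copy is shrunk and removed. Both \<open>y\<close> and \<open>p\<close> vary because
  the induction hypothesis is applied below the copy.\<close>

lemma insert_tree:
  assumes "node_types (Suc m) {#t#} \<subseteq> node_types (Suc m) s" "def_type m y = def_type m t"
  shows "val (s + subst {#y#} p) = val (s + subst {#y, t#} p)"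
  using assms
proof (induction t arbitrary: y p)
  case (Node a f)
  have "def_type (Suc m) (Node a f) \<in> node_types (Suc m) s"
    using Node.prems(1) by (simp del: def_type.simps)
  then obtain x where x: "x \<in> nodes s" "def_type (Suc m) x = def_type (Suc m) (Node a f)"
    unfolding node_types_def by (metis imageE)
  obtain g where g: "x = Node a g" "root_types m f = root_types m g"
    using x(2) by (metis tree.exhaust def_type_Suc_eq_iff)
  have xy: "def_type m x = def_type m y"
    using def_type_antimono[OF x(2)] Node.prems(2) by simp
  \<comment> \<open>The forest \<open>u\<close> allows two uses: growing the copy with
    \<open>{#y#}\<close>, and shrinking it after the split with
    \<open>{#y, Node a f#}\<close>.\<close>
  have grow: "val (s + subst (u + {#Node a (g + e)#}) p) = val (s + subst (u + {#x#}) p)"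
    if "e \<subseteq># f" for e u
    using that
  proof (induction e)
    case (add t e)
    then have "t \<in># f" by (auto dest: mset_subset_eqD)
    then obtain z where z: "z \<in># g" "def_type m z = def_type m t"
      using g(2) unfolding root_types_def by (metis imageE imageI)
    \<comment> \<open>The hole takes the place of \<open>z\<close>, a child of the copy with the
      \<open>m\<close>-type of \<open>t\<close>, so the induction hypothesis puts \<open>t\<close>
      beside it.\<close>
    define q where "q = ctx_comp (CNode u a (CHole ((g - {#z#}) + e))) p"
    have "node_types (Suc m) {#t#} \<subseteq> node_types (Suc m) f"
      using \<open>t \<in># f\<close> by (rule node_types_mem)
    then have "node_types (Suc m) {#t#} \<subseteq> node_types (Suc m) s"
      using Node.prems(1) by auto
    from Node.IH[OF \<open>t \<in># f\<close> this z(2), of q]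
    have "val (s + subst {#z#} q) = val (s + subst {#z, t#} q)" .
    moreover have "{#z#} + ((g - {#z#}) + e) = g + e" "{#z, t#} + ((g - {#z#}) + e) = g + add_mset t e"
      using z(1) by (simp_all add: add_mset_commute[of z t])
    ultimately have "val (s + subst (u + {#Node a (g + e)#}) p) = val (s + subst (u + {#Node a (g + add_mset t e)#}) p)"
      unfolding q_def subst_comp by (simp only: subst.simps)
    then show ?case
      using add by (metis subset_mset.dual_order.trans mset_subset_eq_insertD subset_mset.less_imp_le)
  qed (simp add: g(1))
  have "val (s + subst {#y#} p) = val (s + subst {#y, x#} p)"
    by (rule transfer_subtree[OF x(1) xy])
  also have "\<dots> = val (s + subst ({#y#} + {#Node a (g + f)#}) p)"
    using grow[OF subset_mset.order_refl, of "{#y#}"] by (simp add: add_mset_commute)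
  also have "\<dots> = val (s + subst ({#y#} + {#Node a (g + f), Node a f#}) p)"
    by (intro val_add val_subst refl split_node g(2))
  also have "\<dots> = val (s + subst ({#y, Node a f#} + {#Node a (g + f)#}) p)"
    by (simp add: ac_simps add_mset_commute)
  also have "\<dots> = val (s + subst ({#y, Node a f#} + {#x#}) p)"
    by (rule grow) simp
  \<comment> \<open>With \<open>Node a f\<close> moved into the context,
    \<open>transfer_subtree\<close> read backwards removes \<open>x\<close>.\<close>
  also have "\<dots> = val (s + subst {#y, x#} (ctx_comp (CHole {#Node a f#}) p))"
    by (simp add: subst_comp add_mset_commute)
  also have "\<dots> = val (s + subst {#y#} (ctx_comp (CHole {#Node a f#}) p))"
    by (rule transfer_subtree[OF x(1) xy, symmetric])
  also have "\<dots> = val (s + subst {#y, Node a f#} p)"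
    by (simp add: subst_comp add_mset_commute)
  finally show ?case .
qed

text \<open>Idempotency supplies a second copy of \<open>s\<close>: one is the reservoir for
  \<open>insert_tree\<close>, the other receives each tree of \<open>t\<close> beside a root of the
  same \<open>m\<close>-type.\<close>

lemma absorb_forest:
  assumes "root_types m t \<subseteq> root_types m s" "node_types (Suc m) t \<subseteq> node_types (Suc m) s"
  shows "val (s + t) = val s"
proof (rule val_absorb)
  fix x assume "x \<in># t"
  then obtain y where y: "y \<in># s" "def_type m y = def_type m x"
    using assms(1) unfolding root_types_def by (metis imageE imageI subsetD)
  have "node_types (Suc m) {#x#} \<subseteq> node_types (Suc m) s"
    using assms(2) node_types_mem[OF \<open>x \<in># t\<close>] by blast
  from insert_tree[OF this y(2), of "CHole (s - {#y#})"] y(1)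
  have "val (s + s) = val ((s + s) + {#x#})"
    by (simp add: add_mset_commute)
  also have "\<dots> = val (s + {#x#})"
    by (intro val_add val_idem refl)
  finally show "val (s + {#x#}) = val s"
    by (simp add: val_idem)
qed

lemma k_locally_testable: "k_locally_testable (Suc m) L"
proof -
  have "t \<in> L" if "(s, t) \<in> loc_equiv (Suc m)" "s \<in> L" for s t
  proof -
    have "val (s + t) = val s" "val (t + s) = val t"
      using that(1) by (auto simp: loc_equiv_iff intro!: absorb_forest)
    then have "(s, t) \<in> syn_cong_hor L"
      by (simp add: add.commute val_eq_iff[symmetric])
    then have "subst s (CHole {#}) \<in> L \<longleftrightarrow> subst t (CHole {#}) \<in> L"
      unfolding syn_cong_hor_def by blast
    then show "t \<in> L" using that(2) by simp
  qed
  then show ?thesis by (auto simp: k_locally_testable_iff)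
qed

end

section \<open>Finiteness of \<open>H\<^sub>L\<close> and the final bound\<close>

lemma regular_finite_syn_cong_hor:
  fixes L :: "'a forest set"
  assumes "regular_forest_lang L"
  shows "finite (UNIV // syn_cong_hor L)"
proof -
  obtain F :: "(nat, nat) forest_alg" and \<alpha> \<beta> X where fin: "finite_forest_alg F"
    and hom: "(\<alpha>, \<beta>) \<in> forest_alg_hom free_forest_alg F" and L: "L = \<alpha> -` X"
    using assms unfolding regular_forest_lang_def recognizes_def by blast
  have act: "\<alpha> (subst s p) = act F (\<alpha> s) (\<beta> p)" and mem: "\<alpha> s \<in> carrier (hor F)" for s p
    using hom by (auto simp: forest_alg_hom_def monoid_hom_def hom_def free_forest_alg_def)
  \<comment> \<open>The kernel of \<alpha> refines the syntactic congruence, so there are at most as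
    many classes as elements in the finite carrier.\<close>
  have eq: "syn_cong_hor L `` {s} = syn_cong_hor L `` {t}" if "\<alpha> s = \<alpha> t" for s t
    using that by (intro equiv_class_eq[OF equiv_syn_cong_hor]) (simp add: syn_cong_hor_def L act)
  have "UNIV // syn_cong_hor L \<subseteq> (\<lambda>h. syn_cong_hor L `` {SOME s. \<alpha> s = h}) ` carrier (hor F)"
  proof
    fix S assume "S \<in> UNIV // syn_cong_hor L"
    then obtain s where s: "S = syn_cong_hor L `` {s}"
      by (auto elim: quotientE)
    have "\<alpha> (SOME t. \<alpha> t = \<alpha> s) = \<alpha> s"
      by (rule someI) (rule refl)
    then show "S \<in> (\<lambda>h. syn_cong_hor L `` {SOME s. \<alpha> s = h}) ` carrier (hor F)"
      using eq mem s by blast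
  qed
  then show ?thesis
    using fin finite_subset unfolding finite_forest_alg_def by blast
qed

theorem theorem7:
  fixes L :: "'a::finite forest set"
  assumes "regular_forest_lang L"
    and "locally_testable L"
  shows "k_locally_testable (card (carrier (hor (syntactic_forest_alg L))) ^ 2 + 1) L"
proof -
  obtain k where "k_locally_testable k L"
    using assms(2) unfolding locally_testable_def by blast
  then obtain l where l: "\<And>s t. (s, t) \<in> loc_equiv (Suc l) \<Longrightarrow> s \<in> L \<Longrightarrow> t \<in> L"
    unfolding k_locally_testable_iff by (metis Suc_pred)
  interpret loc_testable_lang L l
    by unfold_locales (rule l)
  \<comment> \<open>Here \<open>m\<close> is the depth of the root types; node types are one deeper,
    which gives the \<open>+ 1\<close> of the bound.\<close>
  interpret loc_testable_pairs L l "card (UNIV // syn_cong_hor L) ^ 2"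
    by unfold_locales (rule val_pairs_stable[OF regular_finite_syn_cong_hor[OF assms(1)]])
  show ?thesis
    using k_locally_testable by (simp add: syntactic_carrier)
qed

end
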